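(* Let $\mathbf{RLSg}$, $\mathbf{SLSg}$, $\mathbf{LSg}$ and $\mathbf{PSg}$ denote the classes of refined locality semigroups, strong locality semigroups, locality semigroups and partial semigroups, respectively. Then $$\mathbf{RLSg}\subsetneq\mathbf{SLSg}\subsetneq\mathbf{LSg}\cap\mathbf{PSg},$$ and moreover $\mathbf{LSg}\nsubseteq\mathbf{PSg}$ and $\mathbf{PSg}\nsubseteq\mathbf{LSg}$.
   Context: A locality set is a pair $(S,\top)$ with $S$ a set and $\top\subseteq S\times S$. A partial binary operation on it is a map $\mu_S:\top\to S$, $(a,b)\mapsto ab$. All four classes consist of triples $(S,\top,\mu_S)$ of this kind satisfying further axioms, and inclusions are between classes of such triples. For $U\subseteq S$ put ${}^\top U:=\{x\in S\mid (x,u)\in\top \text{ for all }u\in U\}$ and $U^\top:=\{x\in S\mid (u,x)\in\top\text{ for all }u\in U\}$. Locality semigroup: for all $U\subseteq S$, $\mu_S(({}^\top U\times{}^\top U)\cap\top)\subseteq{}^\top U$ and $\mu_S((U^\top\times U^\top)\cap\top)\subseteq U^\top$; and for all $a,b,c\in S$, $(a,b),(b,c),(a,c)\in\top$ implies $(ab)c=a(bc)$. Strong locality semigroup: for all $a,b,c\in S$, if $(a,b),(b,c)\in\top$, then $(ab,c),(a,bc)\in\top$ and $(ab)c=a(bc)$. Partial semigroup: for all $a,b,c\in S$ with $(a,b),(b,c)\in\top$, one has $(ab,c)\in\top$ if and only if $(a,bc)\in\top$, and in that case $(ab)c=a(bc)$. Refined locality semigroup: for all $a,b,c\in S$: (i)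 if $(a,b)\in\top$, then $(b,c)\in\top$ if and only if $(ab,c)\in\top$; (ii) if $(b,c)\in\top$, then $(a,b)\in\top$ if and only if $(a,bc)\in\top$; (iii) if $(a,b),(b,c)\in\top$, then $(ab)c=a(bc)$. *)

theory Defs
  imports Main "HOL-Library.FuncSet"
begin

text \<open>
  A triple \<open>(S, T, \<mu>)\<close> of a carrier \<open>S\<close>, a relation \<open>T\<close> and a partial operation \<open>\<mu>\<close>
  with domain of definition \<open>T\<close>. Carriers range over all subsets of the type.
\<close>
type_synonym 'a triple = "'a set \<times> ('a \<times> 'a) set \<times> ('a \<times> 'a \<Rightarrow> 'a)"

definition locality_set :: "'a set \<Rightarrow> ('a \<times> 'a) set \<Rightarrow> bool" where
  "locality_set S T \<longleftrightarrow> T \<subseteq> S \<times> S"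

text \<open>
  The extensional function space fixes the values of \<open>\<mu>\<close> outside \<open>T\<close>, so that elements of
  \<open>T \<rightarrow>\<^sub>E S\<close> are exactly the maps from \<open>T\<close> to \<open>S\<close>, with equality of maps as equality.
\<close>
definition partial_magma :: "'a set \<Rightarrow> ('a \<times> 'a) set \<Rightarrow> ('a \<times> 'a \<Rightarrow> 'a) \<Rightarrow> bool" where
  "partial_magma S T \<mu> \<longleftrightarrow> locality_set S T \<and> \<mu> \<in> T \<rightarrow>\<^sub>E S"

definition left_polar :: "'a set \<Rightarrow> ('a \<times> 'a) set \<Rightarrow> 'a set \<Rightarrow> 'a set" where
  "left_polar S T U = {x \<in> S. \<forall>u\<in>U. (x, u) \<in> T}"

definition right_polar :: "'a set \<Rightarrow> ('a \<times> 'a) set \<Rightarrow> 'a set \<Rightarrow> 'a set" where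
  "right_polar S T U = {x \<in> S. \<forall>u\<in>U. (u, x) \<in> T}"

definition locality_semigroup :: "'a set \<Rightarrow> ('a \<times> 'a) set \<Rightarrow> ('a \<times> 'a \<Rightarrow> 'a) \<Rightarrow> bool" where
  "locality_semigroup S T \<mu> \<longleftrightarrow>
     partial_magma S T \<mu> \<and>
     (\<forall>U\<subseteq>S.
        \<mu> ` ((left_polar S T U \<times> left_polar S T U) \<inter> T) \<subseteq> left_polar S T U \<and>
        \<mu> ` ((right_polar S T U \<times> right_polar S T U) \<inter> T) \<subseteq> right_polar S T U) \<and>
     (\<forall>a\<in>S. \<forall>b\<in>S. \<forall>c\<in>S.
        (a, b) \<in> T \<and> (b, c) \<in> T \<and> (a, c) \<in> T \<longrightarrow> \<mu> (\<mu> (a, b), c) = \<mu> (a, \<mu> (b, c)))"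

definition strong_locality_semigroup :: "'a set \<Rightarrow> ('a \<times> 'a) set \<Rightarrow> ('a \<times> 'a \<Rightarrow> 'a) \<Rightarrow> bool" where
  "strong_locality_semigroup S T \<mu> \<longleftrightarrow>
     partial_magma S T \<mu> \<and>
     (\<forall>a\<in>S. \<forall>b\<in>S. \<forall>c\<in>S.
        (a, b) \<in> T \<and> (b, c) \<in> T \<longrightarrow>
          (\<mu> (a, b), c) \<in> T \<and> (a, \<mu> (b, c)) \<in> T \<and> \<mu> (\<mu> (a, b), c) = \<mu> (a, \<mu> (b, c)))"

definition partial_semigroup :: "'a set \<Rightarrow> ('a \<times> 'a) set \<Rightarrow> ('a \<times> 'a \<Rightarrow> 'a) \<Rightarrow> bool" where
  "partial_semigroup S T \<mu> \<longleftrightarrow>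
     partial_magma S T \<mu> \<and>
     (\<forall>a\<in>S. \<forall>b\<in>S. \<forall>c\<in>S.
        (a, b) \<in> T \<and> (b, c) \<in> T \<longrightarrow>
          ((\<mu> (a, b), c) \<in> T \<longleftrightarrow> (a, \<mu> (b, c)) \<in> T) \<and>
          ((\<mu> (a, b), c) \<in> T \<longrightarrow> \<mu> (\<mu> (a, b), c) = \<mu> (a, \<mu> (b, c))))"

definition refined_locality_semigroup :: "'a set \<Rightarrow> ('a \<times> 'a) set \<Rightarrow> ('a \<times> 'a \<Rightarrow> 'a) \<Rightarrow> bool" where
  "refined_locality_semigroup S T \<mu> \<longleftrightarrow>
     partial_magma S T \<mu> \<and>
     (\<forall>a\<in>S. \<forall>b\<in>S. \<forall>c\<in>S.
        ((a, b) \<in> T \<longrightarrow> ((b, c) \<in> T \<longleftrightarrow> (\<mu> (a, b), c) \<in> T)) \<and>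
        ((b, c) \<in> T \<longrightarrow> ((a, b) \<in> T \<longleftrightarrow> (a, \<mu> (b, c)) \<in> T)) \<and>
        ((a, b) \<in> T \<and> (b, c) \<in> T \<longrightarrow> \<mu> (\<mu> (a, b), c) = \<mu> (a, \<mu> (b, c))))"

definition LSg :: "'a triple set" where
  "LSg = {(S, T, \<mu>). locality_semigroup S T \<mu>}"

definition SLSg :: "'a triple set" where
  "SLSg = {(S, T, \<mu>). strong_locality_semigroup S T \<mu>}"

definition PSg :: "'a triple set" where
  "PSg = {(S, T, \<mu>). partial_semigroup S T \<mu>}"

definition RLSg :: "'a triple set" where
  "RLSg = {(S, T, \<mu>). refined_locality_semigroup S T \<mu>}"

end

theory Submission
  imports Defs
begin

text \<open>
  Closure of the polars of all subsets under products is equivalent to a first-order condition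
  on triples: if three elements are pairwise related, then so are the product of the first two
  with the third, and the first with the product of the last two. It suffices to test polars of
  singletons, since every polar is an intersection of these. In this form a locality semigroup
  assumes three relations and draws the conclusion that a strong one draws from two of them, so
  strong implies locality. Strong also implies partial, since both sides of the equivalence
  then hold; and the refined conditions contain the strong ones.

  All four separations occur on two elements. Let \<open>a \<noteq> b\<close>.
  \<^item> If all products except \<open>a a\<close> are defined and equal \<open>b\<close>, then the triple is strong, because
    \<open>b\<close> is related to everything; but
    \<open>(b a) a\<close> is defined while \<open>a a\<close> is not, so it is not refined.
  \<^item> If exactly \<open>a b\<close> and \<open>b a\<close> are defined, then three elements are never pairwise related, so
    every choice of the two products gives a locality semigroup. Taking \<open>a b = b a = a\<close>, neither
    \<open>(a b) a\<close> nor \<open>a (b a)\<close> is defined: this is a partial semigroup that is not strong. Taking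
    \<open>a b = a\<close> and \<open>b a = b\<close>, only \<open>a (b a)\<close> is defined, so this is not a partial semigroup.
  \<^item> If only \<open>a a = b\<close> is defined, there are no triple products at all, so this is a partial
    semigroup; but the polar \<open>{a}\<close> of \<open>{a}\<close> is not closed.
\<close>

text \<open>
  The polar of the empty set is the whole carrier and is closed because the operation takes
  values there; every other polar is treated one related element \<open>u\<close> at a time.
\<close>
lemma locality_semigroup_iff_pointwise:
  "locality_semigroup S T \<mu> \<longleftrightarrow>
     partial_magma S T \<mu> \<and>
     (\<forall>x y z. (x, y) \<in> T \<and> (y, z) \<in> T \<and> (x, z) \<in> T \<longrightarrow>
        (\<mu> (x, y), z) \<in> T \<and> (x, \<mu> (y, z)) \<in> T \<and> \<mu> (\<mu> (x, y), z) = \<mu> (x, \<mu> (y, z)))"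
  (is "?L \<longleftrightarrow> ?M \<and> ?P")
proof
  assume L: ?L
  then have M: ?M
    unfolding locality_semigroup_def by (elim conjE)
  from L have polars: "\<mu> ` ((left_polar S T U \<times> left_polar S T U) \<inter> T) \<subseteq> left_polar S T U"
      "\<mu> ` ((right_polar S T U \<times> right_polar S T U) \<inter> T) \<subseteq> right_polar S T U" if "U \<subseteq> S" for U
    using that by (simp_all add: locality_semigroup_def)
  from L have assoc: "\<mu> (\<mu> (x, y), z) = \<mu> (x, \<mu> (y, z))"
    if "x \<in> S" "y \<in> S" "z \<in> S" "(x, y) \<in> T" "(y, z) \<in> T" "(x, z) \<in> T" for x y z
    using that by (simp add: locality_semigroup_def)
  have ?P
  proof (intro allI impI)
    fix x y z
    assume T: "(x, y) \<in> T \<and> (y, z) \<in> T \<and> (x, z) \<in> T"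
    with M have S: "x \<in> S" "y \<in> S" "z \<in> S"
      by (auto simp: partial_magma_def locality_set_def)
    have "\<mu> (x, y) \<in> left_polar S T {z}"
      using S T by (intro polars(1)[THEN subsetD, OF _ imageI]) (auto simp: left_polar_def)
    moreover have "\<mu> (y, z) \<in> right_polar S T {x}"
      using S T by (intro polars(2)[THEN subsetD, OF _ imageI]) (auto simp: right_polar_def)
    ultimately show "(\<mu> (x, y), z) \<in> T \<and> (x, \<mu> (y, z)) \<in> T \<and>
        \<mu> (\<mu> (x, y), z) = \<mu> (x, \<mu> (y, z))"
      using assoc S T by (simp add: left_polar_def right_polar_def)
  qed
  with M show "?M \<and> ?P" ..
next
  assume MP: "?M \<and> ?P"
  then have M: ?M ..
  from MP have P: ?P ..
  have closed: "\<mu> (x, y) \<in> S" if "(x, y) \<in> T" for x y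
    using M that by (auto simp: partial_magma_def)
  have "\<mu> ` ((left_polar S T U \<times> left_polar S T U) \<inter> T) \<subseteq> left_polar S T U" for U
  proof
    fix p
    assume "p \<in> \<mu> ` ((left_polar S T U \<times> left_polar S T U) \<inter> T)"
    then obtain x y where p: "p = \<mu> (x, y)" and xy: "(x, y) \<in> T"
      and "x \<in> left_polar S T U" "y \<in> left_polar S T U"
      by blast
    then have "\<forall>u\<in>U. (x, u) \<in> T \<and> (y, u) \<in> T"
      by (simp add: left_polar_def)
    with P xy closed p show "p \<in> left_polar S T U"
      unfolding left_polar_def by blast
  qed
  moreover have "\<mu> ` ((right_polar S T U \<times> right_polar S T U) \<inter> T) \<subseteq> right_polar S T U" for U
  proof
    fix p
    assume "p \<in> \<mu> ` ((right_polar S T U \<times> right_polar S T U) \<inter> T)"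
    then obtain x y where p: "p = \<mu> (x, y)" and xy: "(x, y) \<in> T"
      and "x \<in> right_polar S T U" "y \<in> right_polar S T U"
      by blast
    then have "\<forall>u\<in>U. (u, x) \<in> T \<and> (u, y) \<in> T"
      by (simp add: right_polar_def)
    with P xy closed p show "p \<in> right_polar S T U"
      unfolding right_polar_def by blast
  qed
  ultimately show ?L
    using M P by (simp add: locality_semigroup_def)
qed

lemma RLSg_subset_SLSg: "RLSg \<subseteq> SLSg"
  unfolding RLSg_def SLSg_def refined_locality_semigroup_def strong_locality_semigroup_def
  by blast

lemma SLSg_subset_LSg: "SLSg \<subseteq> LSg"
proof -
  have "locality_semigroup S T \<mu>" if "strong_locality_semigroup S T \<mu>" for S T and \<mu> :: "'a \<times> 'a \<Rightarrow> 'a"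
    using that
    unfolding locality_semigroup_iff_pointwise strong_locality_semigroup_def
      partial_magma_def locality_set_def
    by blast
  then show ?thesis by (auto simp: SLSg_def LSg_def)
qed

lemma SLSg_subset_PSg: "SLSg \<subseteq> PSg"
  unfolding SLSg_def PSg_def strong_locality_semigroup_def partial_semigroup_def
  by blast

lemma strong_not_refined:
  fixes a b :: 'a
  assumes "a \<noteq> b"
  shows "\<exists>t :: 'a triple. t \<in> SLSg \<and> t \<notin> RLSg"
proof -
  let ?S = "{a, b}" and ?T = "{(a, b), (b, a), (b, b)}"
  let ?m = "restrict (\<lambda>_. b) ?T"
  have "strong_locality_semigroup ?S ?T ?m"
    using assms
    by (auto simp: strong_locality_semigroup_def partial_magma_def locality_set_def)
  moreover have "\<not> refined_locality_semigroup ?S ?T ?m"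
  proof
    assume "refined_locality_semigroup ?S ?T ?m"
    then have "(b, a) \<in> ?T \<longrightarrow> ((a, a) \<in> ?T \<longleftrightarrow> (?m (b, a), a) \<in> ?T)"
      unfolding refined_locality_semigroup_def by blast
    with assms show False by simp
  qed
  ultimately show ?thesis unfolding SLSg_def RLSg_def by blast
qed

text \<open>
  Related elements are distinct here, so a triple of pairwise related elements would need three
  elements, and the pointwise condition holds vacuously for every choice of values.
\<close>
lemma locality_semigroup_off_diagonal_pair:
  assumes "a \<noteq> b" and "\<mu> \<in> {(a, b), (b, a)} \<rightarrow>\<^sub>E {a, b}"
  shows "locality_semigroup {a, b} {(a, b), (b, a)} \<mu>"
  using assms
  by (auto simp: locality_semigroup_iff_pointwise partial_magma_def locality_set_def)

lemma locality_partial_not_strong: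
  fixes a b :: 'a
  assumes "a \<noteq> b"
  shows "\<exists>t :: 'a triple. t \<in> LSg \<inter> PSg \<and> t \<notin> SLSg"
proof -
  let ?S = "{a, b}" and ?T = "{(a, b), (b, a)}"
  let ?m = "restrict (\<lambda>_. a) ?T"
  have "locality_semigroup ?S ?T ?m"
    using assms by (intro locality_semigroup_off_diagonal_pair) auto
  moreover have "partial_semigroup ?S ?T ?m"
    using assms by (auto simp: partial_semigroup_def partial_magma_def locality_set_def)
  moreover have "\<not> strong_locality_semigroup ?S ?T ?m"
  proof
    assume "strong_locality_semigroup ?S ?T ?m"
    then have "(a, b) \<in> ?T \<and> (b, a) \<in> ?T \<longrightarrow> (?m (a, b), a) \<in> ?T"
      unfolding strong_locality_semigroup_def by blast
    with assms show False by simp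
  qed
  ultimately show ?thesis unfolding SLSg_def LSg_def PSg_def by blast
qed

lemma locality_not_partial:
  fixes a b :: 'a
  assumes "a \<noteq> b"
  shows "\<exists>t :: 'a triple. t \<in> LSg \<and> t \<notin> PSg"
proof -
  let ?S = "{a, b}" and ?T = "{(a, b), (b, a)}"
  let ?m = "restrict fst ?T"
  have "locality_semigroup ?S ?T ?m"
    using assms by (intro locality_semigroup_off_diagonal_pair) auto
  moreover have "\<not> partial_semigroup ?S ?T ?m"
  proof
    assume "partial_semigroup ?S ?T ?m"
    then have "(a, b) \<in> ?T \<and> (b, a) \<in> ?T \<longrightarrow>
        ((?m (a, b), a) \<in> ?T \<longleftrightarrow> (a, ?m (b, a)) \<in> ?T)"
      unfolding partial_semigroup_def by blast
    with assms show False by simp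
  qed
  ultimately show ?thesis unfolding LSg_def PSg_def by blast
qed

lemma partial_not_locality:
  fixes a b :: 'a
  assumes "a \<noteq> b"
  shows "\<exists>t :: 'a triple. t \<in> PSg \<and> t \<notin> LSg"
proof -
  let ?S = "{a, b}" and ?T = "{(a, a)}"
  let ?m = "restrict (\<lambda>_. b) ?T"
  have "partial_semigroup ?S ?T ?m"
    using assms by (auto simp: partial_semigroup_def partial_magma_def locality_set_def)
  moreover have "\<not> locality_semigroup ?S ?T ?m"
    using assms by (auto simp: locality_semigroup_iff_pointwise)
  ultimately show ?thesis unfolding LSg_def PSg_def by blast
qed

theorem theorem3p11:
  shows "(RLSg :: 'a triple set) \<subseteq> SLSg \<and> (SLSg :: 'a triple set) \<subseteq> LSg \<inter> PSg \<and>
    (infinite (UNIV :: 'a set) \<longrightarrow>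
       (RLSg :: 'a triple set) \<subset> SLSg \<and>
       (SLSg :: 'a triple set) \<subset> LSg \<inter> PSg \<and>
       \<not> (LSg :: 'a triple set) \<subseteq> PSg \<and>
       \<not> (PSg :: 'a triple set) \<subseteq> LSg)"
proof (intro conjI impI)
  show RS: "(RLSg :: 'a triple set) \<subseteq> SLSg" by (rule RLSg_subset_SLSg)
  show SLP: "(SLSg :: 'a triple set) \<subseteq> LSg \<inter> PSg"
    using SLSg_subset_LSg SLSg_subset_PSg by blast
  assume inf: "infinite (UNIV :: 'a set)"
  obtain a b :: 'a where ab: "a \<noteq> b"
  proof -
    have "UNIV \<noteq> {undefined :: 'a}"
      using inf by (metis finite.emptyI finite.insertI)
    then show ?thesis using that by blast
  qed
  show "(RLSg :: 'a triple set) \<subset> SLSg" using RS strong_not_refined[OF ab] by blast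
  show "(SLSg :: 'a triple set) \<subset> LSg \<inter> PSg"
    using SLP locality_partial_not_strong[OF ab] by blast
  show "\<not> (LSg :: 'a triple set) \<subseteq> PSg" using locality_not_partial[OF ab] by blast
  show "\<not> (PSg :: 'a triple set) \<subseteq> LSg" using partial_not_locality[OF ab] by blast
qed

end
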